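(* Let $N,M\ge 1$ and $0\le K\le N$ be integers, let $\varepsilon\ge 0$, and let $x\ne x'$ be two response values. Suppose $N$ users take part in the $M$-round protocol described in the context with an $\varepsilon$-sender-anonymous service, and that in each of the $M$ rounds the attacker provides the response $x'$ to exactly $K$ users and $x$ to the other $N-K$ users. Then the probability $p_c$ that the attacker succeeds in providing consistent responses to all $N$ users over all $M$ rounds (i.e. that every user receives $M$ identical responses) satisfies $$p_c\le\binom NK^{1-M}(1+\varepsilon)^M .$$
   Context: Notation: $\mathbb Z_N=\{0,\dots,N-1\}$; $\mathrm{Bij}(A\to B)$ is the set of bijections from $A$ to $B$. Anonymized access. Let $\mathcal U$ be the set of $N$ users. A leakage map $\mathcal L$ is a fixed, possibly randomized, map taking each bijection $\mathcal U\to\mathbb Z_N$ to leaked information in a countable set (if randomized, it uses fresh independent randomness at every use). In one round of anonymous requests, all $N$ users make identical simultaneous requests: a bijection $R_I$ is drawn uniformly from $\mathrm{Bij}(\mathcal U\to\mathbb Z_N)$, independently of all previous rounds; the adversary or attacker (the possibly malicious service, arbitrary, stateful and possibly randomized) is given $\mathcal L(R_I)$ and outputs a response function $R_V:\mathbb Z_N\to\{0,1\}^*$; user $u$ receives $R_V(R_I(u))$. After the round, $(R_I,R_V)$ is appended to the adversary's state, so later behaviour may depend on it. Sender anonymity. Experiment $\mathrm{EXP\text{-}SA}_{\mathcal L,\mathcal U,M}(\mathcal A)$: run $M-1$ rounds of anonymous requests (in each, a bijection is drawn uniformly from $\mathrm{Bij}(\mathcal U\to\mathbb Z_N)$ independently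 of all previous rounds, the adversary $\mathcal A$ is given the leakage of that bijection and outputs a response function, and the bijection and response function are then appended to its state), then an $M$-th round of anonymous requests with mapping $R_I$, drawn in the same way; then the adversary $\mathcal A$, knowing $\mathcal U$, $\mathcal L$, its state (from the first $M-1$ rounds) and the leakage of the $M$-th round, outputs a guess $\hat R\in\mathrm{Bij}(\mathcal U\to\mathbb Z_N)$. The experiment returns $1$ if $\hat R=R_I$ and $0$ otherwise. The service with its anonymizer is $\varepsilon$-sender-anonymous ($\varepsilon\ge0$) if for all adversaries $\mathcal A$, $\Pr[\mathrm{EXP\text{-}SA}_{\mathcal L,\mathcal U,M}(\mathcal A)=1]\le\frac{1}{N!}(1+\varepsilon)$. Protocol: the $N$ users perform $M$ rounds of anonymous requests. *)

theory Defs
  imports "HOL-Probability.Probability" "HOL-Library.FuncSet"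
begin

(* Functions are extensional (undefined outside A), so that each bijection from A to B is
   represented by exactly one element and the set is finite for finite A. *)
definition Bijections :: "'a set \<Rightarrow> 'b set \<Rightarrow> ('a \<Rightarrow> 'b) set" where
  "Bijections A B = {f \<in> extensional A. bij_betw f A B}"

definition request_maps :: "'u set \<Rightarrow> ('u \<Rightarrow> nat) set" where
  "request_maps U = Bijections U {0..<card U}"

(* A randomized map with values in a countable set is a kernel into 'l pmf: every pmf has countable
   support, so no countability constraint on 'l is needed. Drawing from L R anew in each round
   expresses the fresh randomness. *)
type_synonym ('u, 'l) leakage = "('u \<Rightarrow> nat) \<Rightarrow> 'l pmf"

(* R_V; bit strings are bool lists. Only the values below the number of users are ever delivered. *)
type_synonym response_fun = "nat \<Rightarrow> bool list"

(* The adversary's state: its private memory, and the pairs (R_I, R_V) of the completed rounds in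
   chronological order. The memory may hold earlier leakage and coin tosses. A memory of bit strings
   is no restriction, since only countably many states are reachable. *)
type_synonym 'u adv_state = "bool list \<times> (('u \<Rightarrow> nat) \<times> response_fun) list"

(* Given the state and the leakage of the current round: a response function and the new memory. *)
type_synonym ('u, 'l) responder = "'u adv_state \<Rightarrow> 'l \<Rightarrow> (response_fun \<times> bool list) pmf"

type_synonym ('u, 'l) guesser = "'u adv_state \<Rightarrow> 'l \<Rightarrow> ('u \<Rightarrow> nat) pmf"

definition anon_round ::
  "'u set \<Rightarrow> ('u, 'l) leakage \<Rightarrow> ('u, 'l) responder \<Rightarrow> 'u adv_state \<Rightarrow>
    (('u \<Rightarrow> nat) \<times> 'l \<times> response_fun \<times> bool list) pmf" where
  "anon_round U L A s =
    do {
      R \<leftarrow> pmf_of_set (request_maps U);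
      l \<leftarrow> L R;
      (V, m) \<leftarrow> A s l;
      return_pmf (R, l, V, m)
    }"

primrec anon_rounds ::
  "'u set \<Rightarrow> ('u, 'l) leakage \<Rightarrow> ('u, 'l) responder \<Rightarrow> nat \<Rightarrow> 'u adv_state pmf" where
  "anon_rounds U L A 0 = return_pmf ([], [])"
| "anon_rounds U L A (Suc n) =
    do {
      s \<leftarrow> anon_rounds U L A n;
      (R, l, V, m) \<leftarrow> anon_round U L A s;
      return_pmf (m, snd s @ [(R, V)])
    }"

(* The guess sees the state s after M - 1 rounds and the leakage l of the M-th round, not the
   mapping R of the M-th round. *)
definition EXP_SA ::
  "'u set \<Rightarrow> ('u, 'l) leakage \<Rightarrow> nat \<Rightarrow> ('u, 'l) responder \<Rightarrow> ('u, 'l) guesser \<Rightarrow> bool pmf" where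
  "EXP_SA U L M A G =
    do {
      s \<leftarrow> anon_rounds U L A (M - 1);
      (R, l, V, m) \<leftarrow> anon_round U L A s;
      R' \<leftarrow> G s l;
      return_pmf (R' = R)
    }"

definition sender_anonymous ::
  "'u set \<Rightarrow> ('u, 'l) leakage \<Rightarrow> nat \<Rightarrow> real \<Rightarrow> bool" where
  "sender_anonymous U L M \<epsilon> \<longleftrightarrow>
    (\<forall>A G. (\<forall>s l. set_pmf (G s l) \<subseteq> request_maps U) \<longrightarrow>
       pmf (EXP_SA U L M A G) True \<le> 1 / fact (card U) * (1 + \<epsilon>))"

definition splits_users ::
  "'u set \<Rightarrow> nat \<Rightarrow> bool list \<Rightarrow> bool list \<Rightarrow> ('u \<Rightarrow> nat) \<Rightarrow> response_fun \<Rightarrow> bool" where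
  "splits_users U K x x' R V \<longleftrightarrow>
    card {u \<in> U. V (R u) = x'} = K \<and> card {u \<in> U. V (R u) = x} = card U - K"

definition consistent_responses :: "'u set \<Rightarrow> 'u adv_state \<Rightarrow> bool" where
  "consistent_responses U s \<longleftrightarrow> (\<forall>u\<in>U. \<exists>y. \<forall>(R, V)\<in>set (snd s). V (R u) = y)"

end

theory Submission
  imports Defs "HOL-Combinatorics.Permutations"
begin

text \<open>
  Sender anonymity, tested against the maximum-likelihood guesser, says
  \<open>(\<Sum>l. max\<^sub>R P(l | R)) \<le> 1 + \<epsilon>\<close>. This bound no longer mentions the state, so it applies to every
  round. The responses of the first round fix a \<open>K\<close>-subset of the users; given a leakage \<open>l\<close> and
  a response function, at most \<open>K! (N - K)!\<close> mappings reproduce that subset, each of conditional weight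
  at most \<open>max\<^sub>R P(l | R) / N!\<close>. Hence every later round is consistent with the first with
  conditional probability at most \<open>(1 + \<epsilon>) / (N choose K)\<close>, and there are \<open>M - 1\<close> later rounds.
\<close>

section \<open>Counting bijections\<close>

lemma finite_Bijections:
  assumes "finite A" "finite B"
  shows "finite (Bijections A B)"
proof (rule finite_subset)
  show "Bijections A B \<subseteq> PiE A (\<lambda>_. B)"
    by (auto simp: Bijections_def PiE_def dest: bij_betwE)
  show "finite (PiE A (\<lambda>_. B))"
    using assms by (intro finite_PiE) auto
qed

text \<open>Composition with the fixed bijection \<open>h\<close> identifies permutations of
  \<open>A\<close> with bijections from \<open>A\<close> to \<open>B\<close>.\<close>

lemma card_Bijections:
  assumes "finite A" "bij_betw h A B"
  shows "card (Bijections A B) = fact (card A)"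
proof -
  have "bij_betw (\<lambda>p. restrict (h \<circ> p) A) {p. p permutes A} (Bijections A B)"
  \<comment> \<open>Permutations are the identity outside \<open>A\<close>, members of
    \<open>Bijections A B\<close> are \<open>undefined\<close> there; \<open>restrict\<close> and
    the branch \<open>else a\<close> translate between the two conventions.\<close>
  proof (rule bij_betw_byWitness[where f' = "\<lambda>R a. if a \<in> A then inv_into A h (R a) else a"])
    show "\<forall>p\<in>{p. p permutes A}. (\<lambda>a. if a \<in> A then inv_into A h (restrict (h \<circ> p) A a) else a) = p"
      using assms(2) by (auto simp: fun_eq_iff bij_betw_def permutes_in_image permutes_not_in)
    show "\<forall>R\<in>Bijections A B. restrict (h \<circ> (\<lambda>a. if a \<in> A then inv_into A h (R a) else a)) A = R"
      using assms(2)
      by (auto simp: fun_eq_iff Bijections_def extensional_def restrict_def bij_betw_inv_into_right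
          dest: bij_betwE)
    show "(\<lambda>p. restrict (h \<circ> p) A) ` {p. p permutes A} \<subseteq> Bijections A B"
      using assms(2) by (auto simp: Bijections_def intro: bij_betw_trans[OF permutes_imp_bij])
    show "(\<lambda>R a. if a \<in> A then inv_into A h (R a) else a) ` Bijections A B \<subseteq> {p. p permutes A}"
    proof safe
      fix R assume "R \<in> Bijections A B"
      then have "bij_betw (inv_into A h \<circ> R) A A"
        using assms(2) by (auto simp: Bijections_def intro: bij_betw_trans bij_betw_inv_into)
      then have "bij_betw (\<lambda>a. if a \<in> A then inv_into A h (R a) else a) A A"
        by (rule bij_betw_cong[THEN iffD1, rotated]) simp
      then show "(\<lambda>a. if a \<in> A then inv_into A h (R a) else a) permutes A"
        by (rule bij_imp_permutes) simp
    qed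
  qed
  then show ?thesis
    using assms(1) by (simp add: bij_betw_same_card[symmetric] card_permutations)
qed

text \<open>The inequality also covers sets of different sizes, between which no bijection
  exists.\<close>

lemma card_Bijections_le:
  assumes "finite A"
  shows "card (Bijections A B) \<le> fact (card A)"
proof (cases "Bijections A B = {}")
  case False
  then obtain h where "bij_betw h A B"
    by (auto simp: Bijections_def)
  then show ?thesis
    using assms by (simp add: card_Bijections)
qed simp

lemma finite_request_maps: "finite U \<Longrightarrow> finite (request_maps U)"
  by (simp add: request_maps_def finite_Bijections)

lemma card_request_maps:
  assumes "finite U"
  shows "card (request_maps U) = fact (card U)"
  using ex_bij_betw_finite_nat[OF assms] assms
  by (auto simp: request_maps_def card_Bijections)

lemma request_maps_nonempty: "finite U \<Longrightarrow> request_maps U \<noteq> {}"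
  using card_request_maps by fastforce

text \<open>Such a mapping is determined by its restrictions to \<open>S\<close> and
  \<open>U - S\<close>, which are bijections onto the indices satisfying \<open>P\<close> and onto
  the others. As \<open>P\<close> is arbitrary, the sizes may fail to match, hence only an upper
  bound.\<close>

lemma card_request_maps_fixed_split:
  assumes "finite U" "S \<subseteq> U"
  shows "card {R \<in> request_maps U. \<forall>u\<in>U. P (R u) \<longleftrightarrow> u \<in> S}
    \<le> fact (card S) * fact (card U - card S)"
proof -
  let ?I = "{0..<card U}"
  let ?T = "{i \<in> ?I. P i}"
  let ?X = "{R \<in> request_maps U. \<forall>u\<in>U. P (R u) \<longleftrightarrow> u \<in> S}"
  let ?Y = "Bijections S ?T \<times> Bijections (U - S) (?I - ?T)"
  let ?f = "\<lambda>R. (restrict R S, restrict R (U - S))"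
  have fin: "finite S" "finite (U - S)"
    using assms finite_subset by auto
  have "inj_on ?f ?X"
  proof (rule inj_onI)
    fix R R' assume *: "R \<in> ?X" "R' \<in> ?X" "?f R = ?f R'"
    show "R = R'"
    proof (rule extensionalityI[of _ U])
      show "R \<in> extensional U" "R' \<in> extensional U"
        using * by (auto simp: request_maps_def Bijections_def)
      show "R u = R' u" if "u \<in> U" for u
        using * that by (cases "u \<in> S") (auto simp: restrict_def fun_eq_iff; metis)+
    qed
  qed
  moreover have "?f ` ?X \<subseteq> ?Y"
  proof safe
    fix R assume R: "R \<in> request_maps U" "\<forall>u\<in>U. P (R u) \<longleftrightarrow> u \<in> S"
    then have b: "inj_on R U" "R ` U = ?I"
      by (auto simp: request_maps_def Bijections_def bij_betw_def)
    have "R ` S = ?T" "R ` (U - S) = ?I - ?T"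
      unfolding b(2)[symmetric] using R(2) assms(2) by auto
    then show "restrict R S \<in> Bijections S ?T" "restrict R (U - S) \<in> Bijections (U - S) (?I - ?T)"
      using b(1) assms(2)
      by (auto simp: Bijections_def bij_betw_def inj_on_restrict_eq intro: inj_on_subset)
  qed
  moreover have "finite ?Y"
    using fin by (intro finite_cartesian_product finite_Bijections) auto
  ultimately have "card ?X \<le> card ?Y"
    by (rule card_inj_on_le)
  also have "\<dots> \<le> fact (card S) * fact (card (U - S))"
    using fin by (simp add: card_cartesian_product mult_le_mono card_Bijections_le)
  also have "card (U - S) = card U - card S"
    using assms fin by (simp add: card_Diff_subset)
  finally show ?thesis .
qed

section \<open>From sender anonymity to events of a single round\<close>

lemma fact_ennreal: "(fact n :: ennreal) = ennreal (fact n)"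
  by (metis of_nat_fact ennreal_of_nat_eq_real_of_nat)

lemma fact_mult_divide_fact: "fact n * (x / fact n) = (x :: ennreal)"
  using mult_divide_eq_ennreal[of "fact n" x]
  by (simp add: ennreal_times_divide mult.commute fact_ennreal)

lemma max_likelihood_bound:
  fixes L :: "('u, 'l) leakage"
  assumes "finite U" "sender_anonymous U L M \<epsilon>" "0 \<le> \<epsilon>"
  shows "(\<integral>\<^sup>+ l. ennreal (Max ((\<lambda>R. pmf (L R) l) ` request_maps U)) \<partial>count_space UNIV)
    \<le> ennreal (1 + \<epsilon>)"
proof -
  let ?B = "request_maps U"
  let ?m = "\<lambda>l. Max ((\<lambda>R. pmf (L R) l) ` ?B)"
  note B = finite_request_maps[OF assms(1)] request_maps_nonempty[OF assms(1)]
  have "\<exists>R\<in>?B. pmf (L R) l = ?m l" for l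
    using Max_in[of "(\<lambda>R. pmf (L R) l) ` ?B"] B by fastforce
  \<comment> \<open>\<open>g l\<close> is a maximum-likelihood mapping for the leakage
    \<open>l\<close>.\<close>
  then obtain g where g: "\<And>l. g l \<in> ?B" "\<And>l. pmf (L (g l)) l = ?m l"
    by metis
  \<comment> \<open>The guess depends on the last leakage alone, so a constant responder suffices
    and the earlier rounds integrate out.\<close>
  define A :: "('u, 'l) responder" where "A = (\<lambda>s l. return_pmf (\<lambda>_. [], []))"
  define G :: "('u, 'l) guesser" where "G = (\<lambda>s l. return_pmf (g l))"
  \<comment> \<open>Splitting the maximum according to the value of \<open>g l\<close> turns the
    integral into a sum of the probabilities that \<open>g\<close> recovers \<open>R\<close> from a
    leakage drawn from \<open>L R\<close>.\<close>
  have "(\<integral>\<^sup>+ l. ennreal (?m l) \<partial>count_space UNIV)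
      = (\<integral>\<^sup>+ l. (\<Sum>R\<in>?B. ennreal (pmf (L R) l) * indicator {l. g l = R} l) \<partial>count_space UNIV)"
  proof (rule nn_integral_cong)
    fix l
    have "(\<Sum>R\<in>?B. ennreal (pmf (L R) l) * indicator {l. g l = R} l)
        = (\<Sum>R\<in>?B. if R = g l then ennreal (pmf (L R) l) else 0)"
      by (intro sum.cong) auto
    then show "ennreal (?m l) = (\<Sum>R\<in>?B. ennreal (pmf (L R) l) * indicator {l. g l = R} l)"
      using g B by simp
  qed
  also have "\<dots> = (\<Sum>R\<in>?B. \<integral>\<^sup>+ l. indicator {l. g l = R} l \<partial>measure_pmf (L R))"
    by (simp add: nn_integral_sum nn_integral_measure_pmf)
  \<comment> \<open>The success probability is the average of these probabilities over the
    \<open>N!\<close> mappings.\<close>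
  also have "\<dots> = fact (card U) * ennreal (pmf (EXP_SA U L M A G) True)"
    by (simp add: EXP_SA_def anon_round_def A_def G_def ennreal_pmf_bind bind_assoc_pmf
      bind_return_pmf nn_integral_pmf_of_set B card_request_maps assms(1) indicator_def
      eq_commute[of _ "g _"] fact_mult_divide_fact of_bool_def if_distrib[of ennreal]
      cong: if_cong)
  also have "\<dots> \<le> fact (card U) * ennreal (1 / fact (card U) * (1 + \<epsilon>))"
    using assms(2) g unfolding sender_anonymous_def
    by (intro mult_left_mono ennreal_leI) (auto simp: G_def)
  also have "\<dots> = ennreal (1 + \<epsilon>)"
    using assms(3) by (simp add: ennreal_mult'[symmetric] fact_ennreal)
  finally show ?thesis .
qed

text \<open>Given the leakage, the response is drawn without reference to the mapping, so for each
  leakage at most \<open>b\<close> mappings count on average over the responses, each with at most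
  the maximal likelihood.\<close>

lemma anon_round_prob_le:
  fixes L :: "('u, 'l) leakage"
  assumes "finite U" "sender_anonymous U L M \<epsilon>" "0 \<le> \<epsilon>"
    and card: "\<And>V. card {R \<in> request_maps U. Q R V} \<le> b"
  shows "emeasure (anon_round U L A s) {(R, l, V, m). Q R V}
    \<le> ennreal (real b / fact (card U) * (1 + \<epsilon>))"
proof -
  let ?B = "request_maps U"
  let ?m = "\<lambda>l. Max ((\<lambda>R. pmf (L R) l) ` ?B)"
  note B = finite_request_maps[OF assms(1)] request_maps_nonempty[OF assms(1)]
  let ?h = "\<lambda>R l. \<integral>\<^sup>+ y. indicator {y. Q R (fst y)} y \<partial>measure_pmf (A s l)"
  \<comment> \<open>With the sum over \<open>R\<close> moved inside, the integrand is the number of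
    mappings satisfying \<open>Q\<close> for the drawn response.\<close>
  have h: "(\<Sum>R\<in>?B. ?h R l) \<le> ennreal (real b)" for l
  proof -
    have "(\<Sum>R\<in>?B. ?h R l) = (\<integral>\<^sup>+ y. (\<Sum>R\<in>?B. indicator {y. Q R (fst y)} y) \<partial>measure_pmf (A s l))"
      by (rule nn_integral_sum[symmetric]) simp
    also have "\<dots> \<le> (\<integral>\<^sup>+ y. ennreal (real b) \<partial>measure_pmf (A s l))"
    proof (rule nn_integral_mono)
      fix y
      have "(\<Sum>R\<in>?B. indicator {y. Q R (fst y)} y) = (\<Sum>R\<in>?B. if Q R (fst y) then 1 else 0 :: ennreal)"
        by (intro sum.cong) auto
      also have "\<dots> = of_nat (card {R \<in> ?B. Q R (fst y)})"
        using B by (simp add: sum.If_cases Int_def)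
      also have "\<dots> \<le> of_nat b"
        using card by (intro of_nat_mono)
      finally show "(\<Sum>R\<in>?B. indicator {y. Q R (fst y)} y) \<le> ennreal (real b)"
        by (simp add: ennreal_of_nat_eq_real_of_nat)
    qed
    finally show ?thesis by simp
  qed
  have "emeasure (anon_round U L A s) {(R, l, V, m). Q R V}
      = (\<Sum>R\<in>?B. \<integral>\<^sup>+ l. ?h R l \<partial>measure_pmf (L R)) / fact (card U)"
    by (simp add: anon_round_def nn_integral_pmf_of_set B card_request_maps assms(1) split_beta'
      indicator_def)
  also have "(\<Sum>R\<in>?B. \<integral>\<^sup>+ l. ?h R l \<partial>measure_pmf (L R))
      = (\<integral>\<^sup>+ l. (\<Sum>R\<in>?B. ennreal (pmf (L R) l) * ?h R l) \<partial>count_space UNIV)"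
    by (simp add: nn_integral_sum nn_integral_measure_pmf[of "L _"])
  also have "\<dots> \<le> (\<integral>\<^sup>+ l. ennreal (?m l) * ennreal (real b) \<partial>count_space UNIV)"
  proof (rule nn_integral_mono)
    fix l
    \<comment> \<open>Bounding the likelihoods by their maximum leaves a factor free of
      \<open>R\<close>, so that \<open>h\<close> applies.\<close>
    have "(\<Sum>R\<in>?B. ennreal (pmf (L R) l) * ?h R l) \<le> (\<Sum>R\<in>?B. ennreal (?m l) * ?h R l)"
      using B by (intro sum_mono mult_right_mono ennreal_leI Max_ge) auto
    also have "\<dots> \<le> ennreal (?m l) * ennreal (real b)"
      unfolding sum_distrib_left[symmetric] by (intro mult_left_mono h) simp
    finally show "(\<Sum>R\<in>?B. ennreal (pmf (L R) l) * ?h R l) \<le> ennreal (?m l) * ennreal (real b)" .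
  qed
  also have "\<dots> \<le> ennreal (1 + \<epsilon>) * ennreal (real b)"
    using max_likelihood_bound[OF assms(1-3)] by (simp add: nn_integral_multc mult_right_mono)
  finally have "emeasure (anon_round U L A s) {(R, l, V, m). Q R V}
      \<le> ennreal (1 + \<epsilon>) * ennreal (real b) / fact (card U)"
    by (simp add: divide_right_mono_ennreal)
  also have "\<dots> = ennreal (real b / fact (card U) * (1 + \<epsilon>))"
    using assms(3)
    by (simp add: ennreal_mult'[symmetric] fact_ennreal divide_ennreal mult.commute del: ennreal_plus)
  finally show ?thesis .
qed

section \<open>Consistency across rounds\<close>

lemma emeasure_anon_rounds_Suc:
  "emeasure (anon_rounds U L A (Suc n)) X =
    (\<integral>\<^sup>+ s. emeasure (anon_round U L A s) {(R, l, V, m). (m, snd s @ [(R, V)]) \<in> X}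
      \<partial>measure_pmf (anon_rounds U L A n))"
proof -
  \<comment> \<open>With the case distinction inside \<open>return_pmf\<close>, the inner bind
    becomes a map.\<close>
  have "(\<lambda>(R, l, V, m). return_pmf (m, snd s @ [(R, V)]))
      = (\<lambda>r. return_pmf (case r of (R, l, V, m) \<Rightarrow> (m, snd s @ [(R, V)])))" for s :: "'a adv_state"
    by (auto simp: fun_eq_iff)
  then show ?thesis
    by (auto simp: map_pmf_def[symmetric] emeasure_bind_pmf vimage_def split_beta'
        intro!: nn_integral_cong arg_cong2[where f = emeasure])
qed

lemma length_anon_rounds: "s \<in> set_pmf (anon_rounds U L A n) \<Longrightarrow> length (snd s) = n"
  by (induction n arbitrary: s) auto

text \<open>A round has nonempty support, so every reachable state can be continued. This passes the
  splitting assumption from longer runs down to shorter ones.\<close>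

lemma anon_rounds_history_Suc:
  assumes "s \<in> set_pmf (anon_rounds U L A n)"
  shows "\<exists>s'\<in>set_pmf (anon_rounds U L A (Suc n)). set (snd s) \<subseteq> set (snd s')"
proof -
  obtain R l V m where "(R, l, V, m) \<in> set_pmf (anon_round U L A s)"
    using set_pmf_not_empty by (metis ex_in_conv prod_cases4)
  then show ?thesis
    using assms by (intro bexI[of _ "(m, snd s @ [(R, V)])"]) (auto intro!: bexI[of _ s] rev_bexI[of "(R, l, V, m)"])
qed

text \<open>Consistency once lost is never regained; the indicator records this and lets the bounds
  of successive rounds multiply.\<close>

lemma consistent_round_prob_le:
  assumes "finite U" "K \<le> card U" "0 \<le> \<epsilon>" "sender_anonymous U L M \<epsilon>"
    and "snd s \<noteq> []" "\<forall>(R, V)\<in>set (snd s). splits_users U K x x' R V"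
  shows "emeasure (anon_round U L A s)
      {(R, l, V, m). consistent_responses U (m, snd s @ [(R, V)])}
    \<le> ennreal ((1 + \<epsilon>) / real (card U choose K)) * indicator {s. consistent_responses U s} s"
proof (cases "consistent_responses U s")
  case False
  then have "\<not> consistent_responses U (m, snd s @ [(R, V)])" for R V m
    by (fastforce simp: consistent_responses_def)
  then have *: "{(R, l, V, m). consistent_responses U (m, snd s @ [(R, V)])} = {}"
    by auto
  show ?thesis
    unfolding * by simp
next
  case True
  \<comment> \<open>The first round serves as reference: it fixes the set \<open>S\<close> of users
    who must receive \<open>x'\<close> again.\<close>
  obtain R0 V0 where hd: "(R0, V0) \<in> set (snd s)"
    using assms(5) by (metis list.set_sel(1) surj_pair)
  define S where "S = {u \<in> U. V0 (R0 u) = x'}"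
  let ?Q = "\<lambda>R V. \<forall>u\<in>U. V (R u) = V0 (R0 u)"
  have S: "S \<subseteq> U" "card S = K"
    using hd assms(6) by (auto simp: S_def splits_users_def)
  let ?b = "fact K * fact (card U - K) :: nat"
  have b: "card {R \<in> request_maps U. ?Q R V} \<le> ?b" for V
  proof -
    have "card {R \<in> request_maps U. ?Q R V}
        \<le> card {R \<in> request_maps U. \<forall>u\<in>U. V (R u) = x' \<longleftrightarrow> u \<in> S}"
      using assms(1) by (intro card_mono) (auto simp: S_def finite_request_maps)
    also have "\<dots> \<le> ?b"
      using card_request_maps_fixed_split[OF assms(1) S(1), of "\<lambda>i. V i = x'"] S(2) by simp
    finally show ?thesis .
  qed
  have "emeasure (anon_round U L A s)
      {(R, l, V, m). consistent_responses U (m, snd s @ [(R, V)])}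
    \<le> emeasure (anon_round U L A s) {(R, l, V, m). ?Q R V}"
    using hd by (intro emeasure_mono) (fastforce simp: consistent_responses_def)+
  also have "\<dots> \<le> ennreal (real ?b / fact (card U) * (1 + \<epsilon>))"
    by (rule anon_round_prob_le[OF assms(1,4,3) b])
  \<comment> \<open>\<open>K! (N - K)! / N!\<close> is the reciprocal of the binomial
    coefficient.\<close>
  also have "real ?b / fact (card U) * (1 + \<epsilon>) = (1 + \<epsilon>) / real (card U choose K)"
    by (simp add: binomial_fact[OF assms(2)])
  finally show ?thesis
    using True by simp
qed

lemma consistent_rounds_prob_le:
  assumes "finite U" "K \<le> card U" "0 \<le> \<epsilon>" "sender_anonymous U L M \<epsilon>"
    and "\<forall>s\<in>set_pmf (anon_rounds U L A (Suc n)). \<forall>(R, V)\<in>set (snd s). splits_users U K x x' R V"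
  shows "emeasure (anon_rounds U L A (Suc n)) {s. consistent_responses U s}
    \<le> ennreal (((1 + \<epsilon>) / real (card U choose K)) ^ n)"
  using assms(5)
proof (induction n)
  case 0
  \<comment> \<open>The first round has nothing to agree with, so its bound is the trivial
    1.\<close>
  show ?case
    by (simp add: measure_pmf.emeasure_le_1 del: anon_rounds.simps)
next
  case (Suc n)
  let ?q = "(1 + \<epsilon>) / real (card U choose K)"
  have splits: "\<forall>(R, V)\<in>set (snd s). splits_users U K x x' R V"
    if "s \<in> set_pmf (anon_rounds U L A (Suc n))" for s
    using anon_rounds_history_Suc[OF that] Suc.prems by blast
  have "emeasure (anon_rounds U L A (Suc (Suc n))) {s. consistent_responses U s}
      \<le> (\<integral>\<^sup>+ s. ennreal ?q * indicator {s. consistent_responses U s} s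
          \<partial>measure_pmf (anon_rounds U L A (Suc n)))"
    unfolding emeasure_anon_rounds_Suc[of _ _ _ "Suc n"] mem_Collect_eq
  proof (rule nn_integral_mono_AE, rule AE_pmfI)
    fix s assume s: "s \<in> set_pmf (anon_rounds U L A (Suc n))"
    then have "snd s \<noteq> []"
      using length_anon_rounds by fastforce
    then show "emeasure (anon_round U L A s)
        {(R, l, V, m). consistent_responses U (m, snd s @ [(R, V)])}
      \<le> ennreal ?q * indicator {s. consistent_responses U s} s"
      using splits[OF s] by (intro consistent_round_prob_le[OF assms(1-4)])
  qed
  also have "\<dots> = ennreal ?q * emeasure (anon_rounds U L A (Suc n)) {s. consistent_responses U s}"
    by (simp add: nn_integral_cmult del: anon_rounds.simps)
  also have "\<dots> \<le> ennreal ?q * ennreal (?q ^ n)"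
    using Suc.IH splits by (intro mult_left_mono) auto
  also have "\<dots> = ennreal (?q ^ Suc n)"
    using assms(3) by (simp add: ennreal_mult'[symmetric])
  finally show ?case .
qed

theorem theorem4:
  fixes U :: "'u set" and L :: "('u, 'l) leakage" and A :: "('u, 'l) responder"
    and N M K :: nat and \<epsilon> :: real and x x' :: "bool list"
  assumes "finite U" and "card U = N"
    and "N \<ge> 1" and "M \<ge> 1" and "K \<le> N"
    and "\<epsilon> \<ge> 0" and "x \<noteq> x'"
    and "sender_anonymous U L M \<epsilon>"
    and "\<forall>s\<in>set_pmf (anon_rounds U L A M). \<forall>(R, V)\<in>set (snd s). splits_users U K x x' R V"
  shows "measure_pmf.prob (anon_rounds U L A M) {s. consistent_responses U s}
    \<le> real (N choose K) powi (1 - int M) * (1 + \<epsilon>) ^ M"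
proof -
  obtain n where M: "M = Suc n"
    using assms(4) by (cases M) auto
  have "measure_pmf.prob (anon_rounds U L A M) {s. consistent_responses U s}
      \<le> ((1 + \<epsilon>) / real (N choose K)) ^ n"
    using consistent_rounds_prob_le[of U K \<epsilon> L M A n x x'] assms
    by (simp add: M measure_pmf.emeasure_eq_measure del: anon_rounds.simps)
  also have "\<dots> = real (N choose K) powi (1 - int M) * (1 + \<epsilon>) ^ n"
    by (simp add: M power_divide power_int_minus field_simps)
  \<comment> \<open>Only the \<open>M - 1\<close> later rounds cost a factor
    \<open>1 + \<epsilon>\<close>; one more such factor is at least 1.\<close>
  also have "\<dots> \<le> real (N choose K) powi (1 - int M) * (1 + \<epsilon>) ^ M"
    using assms(6) by (intro mult_left_mono power_increasing) (auto simp: M)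
  finally show ?thesis .
qed

end
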